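(* For all integers $m,n\ge 3$, $s(P_m \,\square\, P_n)=\min\{m,n\}+1$ and $s(K_m\,\square\, P_n)=m+1$.
   Context: Graphs are finite and simple. $P_n$ is the path on $n$ vertices, $K_m$ is the complete graph on $m$ vertices, and $G\,\square\, H$ is the Cartesian product of graphs: vertex set $V(G)\times V(H)$, with $(g,h)$ adjacent to $(g',h')$ iff ($g=g'$ and $hh'\in E(H)$) or ($h=h'$ and $gg'\in E(G)$). Search number $s(G)$: Initially every edge of $G$ is dirty (may harbour an invisible intruder) and no searchers are on $G$. A search strategy is a finite sequence of actions, each being one of: place a searcher on a vertex; move a single searcher along an edge $uv$ from $u$ to $v$; remove a searcher from a vertex. An edge $uv$ is cleared when a searcher traverses it from $u$ to $v$ and either (i) immediately before the move at least two searchers are at $u$, or (ii) immediately before the move at least one searcher is at $u$ and all edges incident with $u$ other than $uv$ are already clear. The intruder moves infinitely fast along any path containing no searchers; thus after any action a clear edge is instantly recontaminated (becomes dirty) whenever an endpoint of it is joined to an endpoint of a dirty edge by a path (possibly a single vertex) none of whose vertices, including its ends, is occupied by a searcher. Recontamination is permitted during a strategy. The strategy succeeds if upon completion all edges are simultaneously clear. The search number $s(G)$ is the minimum number of searchers for which a successful search strategy exists. *)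

theory Defs
  imports "HOL-Library.Multiset"
begin

record 'a ugraph =
  verts :: "'a set"
  edges :: "'a set set"

definition simple_graph :: "'a ugraph \<Rightarrow> bool" where
  "simple_graph G \<longleftrightarrow> finite (verts G) \<and> (\<forall>e\<in>edges G. e \<subseteq> verts G \<and> card e = 2)"

definition path_graph :: "nat \<Rightarrow> nat ugraph" where
  "path_graph n = \<lparr>verts = {..<n}, edges = {{i, Suc i} | i. Suc i < n}\<rparr>"

definition complete_graph :: "nat \<Rightarrow> nat ugraph" where
  "complete_graph m = \<lparr>verts = {..<m}, edges = {{i, j} | i j. i < m \<and> j < m \<and> i \<noteq> j}\<rparr>"

definition cartesian_product :: "'a ugraph \<Rightarrow> 'b ugraph \<Rightarrow> ('a \<times> 'b) ugraph" where
  "cartesian_product G H =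
     \<lparr>verts = verts G \<times> verts H,
      edges = {{(g, h), (g', h')} | g h g' h'.
                 (g, h) \<in> verts G \<times> verts H \<and> (g', h') \<in> verts G \<times> verts H \<and>
                 ((g = g' \<and> {h, h'} \<in> edges H) \<or> (h = h' \<and> {g, g'} \<in> edges G))}\<rparr>"

lemma simple_graph_path_graph: "simple_graph (path_graph n)"
  by (auto simp: simple_graph_def path_graph_def)

lemma simple_graph_complete_graph: "simple_graph (complete_graph m)"
  by (auto simp: simple_graph_def complete_graph_def)

lemma simple_graph_cartesian_product:
  assumes "simple_graph G" "simple_graph H"
  shows "simple_graph (cartesian_product G H)"
proof -
  have "{g, g'} \<in> edges G \<Longrightarrow> g \<noteq> g'" for g g'
    using assms(1) by (fastforce simp: simple_graph_def)
  moreover have "{h, h'} \<in> edges H \<Longrightarrow> h \<noteq> h'" for h h'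
    using assms(2) by (fastforce simp: simple_graph_def)
  ultimately show ?thesis
    using assms by (fastforce simp: simple_graph_def cartesian_product_def card_2_iff)
qed

definition is_path :: "'a ugraph \<Rightarrow> 'a list \<Rightarrow> bool" where
  "is_path G p \<longleftrightarrow> p \<noteq> [] \<and> distinct p \<and> set p \<subseteq> verts G \<and>
     (\<forall>i. Suc i < length p \<longrightarrow> {p ! i, p ! Suc i} \<in> edges G)"

text \<open>
  A state consists of the multiset of vertices occupied by the searchers
  and the set of clear edges; all other edges are dirty.
\<close>

type_synonym 'a state = "'a multiset \<times> 'a set set"

datatype 'a action = Place 'a | Move 'a 'a | Remove 'a

definition initial_state :: "'a state" where
  "initial_state = ({#}, {})"

definition recontaminate :: "'a ugraph \<Rightarrow> 'a state \<Rightarrow> 'a state" where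
  "recontaminate G = (\<lambda>(S, C). (S,
     {e \<in> C. \<not> (\<exists>f \<in> edges G - C. \<exists>p. is_path G p \<and> hd p \<in> e \<and> last p \<in> f \<and>
                 set p \<inter> set_mset S = {})}))"

fun legal :: "'a ugraph \<Rightarrow> 'a state \<Rightarrow> 'a action \<Rightarrow> bool" where
  "legal G (S, C) (Place v) \<longleftrightarrow> v \<in> verts G"
| "legal G (S, C) (Move u v) \<longleftrightarrow> u \<in># S \<and> {u, v} \<in> edges G"
| "legal G (S, C) (Remove v) \<longleftrightarrow> v \<in># S"

definition clears :: "'a ugraph \<Rightarrow> 'a state \<Rightarrow> 'a \<Rightarrow> 'a \<Rightarrow> bool" where
  "clears G = (\<lambda>(S, C) u v.
     count S u \<ge> 2 \<or>
     (count S u \<ge> 1 \<and> (\<forall>e \<in> edges G. u \<in> e \<and> e \<noteq> {u, v} \<longrightarrow> e \<in> C)))"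

text \<open>
  A traversal that meets neither clearing condition moves the searcher
  without clearing the edge.
\<close>

fun act :: "'a ugraph \<Rightarrow> 'a state \<Rightarrow> 'a action \<Rightarrow> 'a state" where
  "act G (S, C) (Place v) = (add_mset v S, C)"
| "act G (S, C) (Move u v) =
     (add_mset v (S - {#u#}), if clears G (S, C) u v then insert {u, v} C else C)"
| "act G (S, C) (Remove v) = (S - {#v#}, C)"

definition step :: "'a ugraph \<Rightarrow> 'a state \<Rightarrow> 'a action \<Rightarrow> 'a state" where
  "step G s a = recontaminate G (act G s a)"

text \<open>
  The number of searchers used is the largest number present on the graph
  at the same time; a removed searcher may be placed again later.
\<close>

fun succeeds :: "'a ugraph \<Rightarrow> nat \<Rightarrow> 'a state \<Rightarrow> 'a action list \<Rightarrow> bool" where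
  "succeeds G k (S, C) [] \<longleftrightarrow> size S \<le> k \<and> edges G \<subseteq> C"
| "succeeds G k (S, C) (a # as) \<longleftrightarrow>
     size S \<le> k \<and> legal G (S, C) a \<and> succeeds G k (step G (S, C) a) as"

definition search_number :: "'a ugraph \<Rightarrow> nat" where
  "search_number G = (LEAST k. \<exists>as. succeeds G k initial_state as)"

end

theory Submission imports Defs begin

text \<open>
  Given the set of clear edges, call a vertex clean if all its edges are clear, dirty if none of
  them is, and a frontier vertex if it has edges of both kinds. Recontamination forces a searcher
  onto every frontier vertex (\<open>frontier_recontaminate\<close>), and once all of them are occupied it
  changes nothing (\<open>recontaminate_guarded\<close>). So searching means growing the clear set while the
  frontier stays small.

  Upper bounds. Each of the products consists of layers in which every vertex has one neighbour in
  the next layer. If the layers have at most \<open>w\<close> vertices, then \<open>w + 1\<close> searchers suffice: \<open>w\<close> of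
  them occupy a layer, the extra one clears the edges inside it, and then each of the \<open>w\<close> searchers
  has a single dirty edge left and may slide along it to the next layer (\<open>layered_sweep\<close>). A grid
  can be swept in either direction, which gives the minimum.

  Lower bounds. Let \<open>k\<close> be the width, \<open>m\<close> or \<open>min m n\<close>, and suppose that \<open>k\<close> searchers are at work.
  When the frontier has fewer than \<open>k\<close> vertices, some lines of the product avoid it. Such a line is
  entirely clean or entirely dirty, and all of them are of the same kind, which makes the state low
  (dirty) or high (clean). The search starts low and ends high. Between the last low state and the
  next high one the frontier has exactly \<open>k\<close> vertices, so the searchers are pinned to it, one on
  each vertex. A searcher who then clears an edge \<open>uv\<close> from \<open>u\<close> must use the second clearing
  condition, so \<open>uv\<close> was the only dirty edge at \<open>u\<close>; and if he does not end this phase, he arrives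
  at a dirty vertex \<open>v\<close>. Hence a vertex of degree at least 3 that was dirty in the last low state
  never has more than one clear edge during the phase: having been entered once, it has too many
  dirty edges to be left. One more clearing does not make it clean in the high state.

  This is the theorem \<open>barrier\<close>: \<open>k\<close> searchers fail if for any low and any high state some vertex
  of degree at least 3 is dirty in the former and clean in the latter. For the complete graph times
  a path such a vertex exists by counting, because low states have no clean vertices and high
  states no dirty ones (\<open>complete_path_separation\<close>). For grids the dirty row and column of the low
  state cross the clean column and row of the high state, and unless one of the crossings is the
  vertex wanted, both are corners. This leaves only square grids in which the frontier of the low
  state has one vertex in each row but an outer one, and there the dirty part of the low state and
  the clean part of the high state overlap in the row next to that outer row (\<open>grid_separation\<close>).
\<close>

section \<open>Frontiers and recontamination\<close>

definition frontier :: "'a ugraph \<Rightarrow> 'a set set \<Rightarrow> 'a set" where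
  "frontier G C = {v \<in> verts G. (\<exists>e\<in>C. v \<in> e) \<and> (\<exists>f\<in>edges G - C. v \<in> f)}"

lemma finite_frontier: "simple_graph G \<Longrightarrow> finite (frontier G C)"
  by (auto simp: simple_graph_def frontier_def)

lemma simple_graph_edge_verts:
  assumes "simple_graph G" "{u, v} \<in> edges G"
  shows "u \<in> verts G" "v \<in> verts G" "u \<noteq> v"
  using assms by (fastforce simp: simple_graph_def)+

lemma edge_nonempty: "simple_graph G \<Longrightarrow> e \<in> edges G \<Longrightarrow> e \<noteq> {}"
  by (auto simp: simple_graph_def)

lemma finite_edges: "simple_graph G \<Longrightarrow> finite (edges G)"
  unfolding simple_graph_def by (rule finite_subset[of _ "Pow (verts G)"]) auto

text \<open>
  Along a path that avoids the searchers, cleanness propagates: its first vertex has a clear edge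
  and is not a frontier vertex, so its edge to the next vertex is clear as well, and so on. Hence
  the path cannot reach a dirty edge.
\<close>

lemma recontaminate_guarded:
  assumes guard: "frontier G C \<subseteq> set_mset S"
  shows "recontaminate G (S, C) = (S, C)"
proof -
  have False
    if e: "e \<in> C" and f: "f \<in> edges G - C" and p: "is_path G p"
      and ends: "hd p \<in> e" "last p \<in> f" and free: "set p \<inter> set_mset S = {}" for e f p
  proof -
    have ne: "p \<noteq> []" and verts: "set p \<subseteq> verts G"
      and adj: "\<And>i. Suc i < length p \<Longrightarrow> {p ! i, p ! Suc i} \<in> edges G"
      using p by (auto simp: is_path_def)
    have notin: "p ! i \<notin> frontier G C" if "i < length p" for i
      using that guard free nth_mem by fastforce
    have "\<exists>e\<in>C. p ! i \<in> e" if "i < length p" for i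
      using that
    proof (induction i)
      case 0
      then show ?case using e ends ne by (auto simp: hd_conv_nth)
    next
      case (Suc i)
      then have "{p ! i, p ! Suc i} \<in> C"
        using notin[of i] adj[of i] subsetD[OF verts nth_mem[of i p]] by (auto simp: frontier_def)
      then show ?case by blast
    qed
    then obtain e' where "e' \<in> C" "last p \<in> e'"
      using ne by (metis last_conv_nth diff_less length_greater_0_conv zero_less_one)
    then have "last p \<in> frontier G C"
      using f ends ne verts last_in_set by (fastforce simp: frontier_def)
    then show False using guard free ne last_in_set by blast
  qed
  then show ?thesis unfolding recontaminate_def prod.case by blast
qed

text \<open>
  The point is that one pass of recontamination suffices. If an unoccupied vertex \<open>v\<close> of a
  surviving edge meets an edge that has just been recontaminated along a path, then that path,
  cut at \<open>v\<close> or extended to \<open>v\<close>, shows that the surviving edge should have been recontaminated too.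
\<close>

lemma frontier_recontaminate:
  assumes G: "simple_graph G" and rec: "recontaminate G (S, C) = (S', C')"
  shows "frontier G C' \<subseteq> set_mset S"
proof
  fix v assume v: "v \<in> frontier G C'"
  let ?Q = "\<lambda>e. \<exists>f\<in>edges G - C. \<exists>p. is_path G p \<and> hd p \<in> e \<and> last p \<in> f \<and> set p \<inter> set_mset S = {}"
  have C': "C' = {e \<in> C. \<not> ?Q e}" using rec by (auto simp: recontaminate_def)
  from v obtain e f where vV: "v \<in> verts G" and e: "e \<in> C'" "v \<in> e"
    and f: "f \<in> edges G" "f \<notin> C'" "v \<in> f" by (auto simp: frontier_def)
  show "v \<in> set_mset S"
  proof (rule ccontr)
    assume vS: "v \<notin> set_mset S"
    have "\<exists>g\<in>edges G - C. \<exists>p. is_path G p \<and> hd p = v \<and> last p \<in> g \<and> set p \<inter> set_mset S = {}"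
    proof (cases "f \<in> C")
      case False
      have "is_path G [v]" using vV by (simp add: is_path_def)
      then show ?thesis using False f vS by (intro bexI[of _ f] exI[of _ "[v]"]) auto
    next
      case True
      then obtain g p where g: "g \<in> edges G - C" and p: "is_path G p" "hd p \<in> f" "last p \<in> g"
        "set p \<inter> set_mset S = {}" using f C' by blast
      have ne: "p \<noteq> []" using p by (simp add: is_path_def)
      show ?thesis
      proof (cases "v \<in> set p")
        case True
        then obtain xs ys where xy: "p = xs @ v # ys" by (meson split_list)
        have "is_path G (v # ys)"
          unfolding is_path_def
        proof (intro conjI allI impI)
          fix i assume i: "Suc i < length (v # ys)"
          have "\<And>j. Suc j < length p \<Longrightarrow> {p ! j, p ! Suc j} \<in> edges G"
            using p(1) by (simp add: is_path_def)
          from this[of "length xs + i"] have "{p ! (length xs + i), p ! Suc (length xs + i)} \<in> edges G"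
            using i xy by simp
          moreover have "p ! (length xs + j) = (v # ys) ! j" for j by (simp add: xy)
          ultimately show "{(v # ys) ! i, (v # ys) ! Suc i} \<in> edges G"
            by (metis add_Suc_right)
        qed (use p xy in \<open>auto simp: is_path_def\<close>)
        then show ?thesis using g p xy by (intro bexI[of _ g] exI[of _ "v # ys"]) auto
      next
        case False
        then have "f = {v, hd p}"
          using f p ne G hd_in_set[OF ne] by (fastforce simp: simple_graph_def card_2_iff)
        then have "is_path G (v # p)"
          using p False vV ne f by (auto simp: is_path_def nth_Cons hd_conv_nth split: nat.split)
        then show ?thesis using g p vS ne by (intro bexI[of _ g] exI[of _ "v # p"]) auto
      qed
    qed
    then have "?Q e" using e by blast
    then show False using e C' by blast
  qed
qed

lemma step_contained:
  assumes "step G (S, C) a = (S', C')"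
  shows "S' = fst (act G (S, C) a)" "C' \<subseteq> snd (act G (S, C) a)"
  using assms by (auto simp: step_def recontaminate_def split: prod.splits)

lemma frontier_step:
  assumes "simple_graph G" "step G (S, C) a = (S', C')"
  shows "frontier G C' \<subseteq> set_mset S'"
proof -
  obtain T D where TD: "act G (S, C) a = (T, D)" by fastforce
  then have r: "recontaminate G (T, D) = (S', C')" using assms by (simp add: step_def)
  then have "S' = T" by (simp add: recontaminate_def)
  then show ?thesis using frontier_recontaminate[OF assms(1) r] by simp
qed

section \<open>A barrier to searching\<close>

definition clean :: "'a ugraph \<Rightarrow> 'a set set \<Rightarrow> 'a \<Rightarrow> bool" where
  "clean G C v \<longleftrightarrow> (\<forall>e\<in>edges G. v \<in> e \<longrightarrow> e \<in> C)"

definition dirty :: "'a set set \<Rightarrow> 'a \<Rightarrow> bool" where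
  "dirty C v \<longleftrightarrow> (\<forall>e\<in>C. v \<notin> e)"

definition degree :: "'a ugraph \<Rightarrow> 'a \<Rightarrow> nat" where
  "degree G v = card {e \<in> edges G. v \<in> e}"

text \<open>
  The invariant of a search with \<open>k\<close> searchers that never gets past the barrier. The witness \<open>C0\<close> is
  the clear set of the most recent low state; the last conjunct bounds what may have happened since
  then at the vertices that were dirty in it.
\<close>

definition confined :: "'a ugraph \<Rightarrow> nat \<Rightarrow> ('a set set \<Rightarrow> bool) \<Rightarrow> 'a set set \<Rightarrow> bool" where
  "confined G k low C \<longleftrightarrow> C \<subseteq> edges G \<and> (card (frontier G C) < k \<longrightarrow> low C) \<and>
     (\<exists>C0\<subseteq>edges G. card (frontier G C0) < k \<and> low C0 \<and>
        (\<forall>x. dirty C0 x \<and> degree G x \<ge> 3 \<longrightarrow> card {e \<in> C. x \<in> e} \<le> 1))"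

lemma card_set_mset_less_size:
  assumes "count S u \<ge> 2" shows "card (set_mset S) < size S"
proof -
  have "size S = (\<Sum>x\<in>set_mset S. count S x)" by (rule size_multiset_overloaded_eq)
  moreover have "(\<Sum>x\<in>set_mset S. 1) < (\<Sum>x\<in>set_mset S. count S x)"
  proof (rule sum_strict_mono_ex1)
    show "\<exists>x\<in>set_mset S. 1 < count S x" using assms by (intro bexI[of _ u]) (auto simp: count_greater_zero_iff[symmetric] simp del: count_greater_zero_iff)
  qed (auto simp: Suc_le_eq)
  ultimately show ?thesis by simp
qed

text \<open>
  A step clears at most one new edge, so afterwards the vertices of degree at least 3 that were
  dirty in \<open>C0\<close> have at most two clear edges. None of them is clean, so by the separation
  hypothesis the new state is low if its frontier is small, and the new clear set can replace \<open>C0\<close>. If the frontier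
  is not small, the bound of one clear edge has to be restored. When the frontier was small before
  the step as well, these vertices had no clear edge at all. Otherwise the searchers are pinned to
  the frontier before and after the step, and the searcher who cleared an edge left a vertex with
  all but one edges clear and arrived at a dirty vertex.
\<close>

lemma confined_step:
  assumes G: "simple_graph G"
    and sep: "\<And>C0 C1. \<lbrakk>C0 \<subseteq> edges G; C1 \<subseteq> edges G; card (frontier G C0) < k;
        card (frontier G C1) < k; low C0; \<not> low C1\<rbrakk>
        \<Longrightarrow> \<exists>x. dirty C0 x \<and> clean G C1 x \<and> degree G x \<ge> 3"
    and conf: "confined G k low C"
    and guard: "frontier G C \<subseteq> set_mset S" and size: "size S \<le> k"
    and legal: "legal G (S, C) a"
    and st: "step G (S, C) a = (S', C')" and size': "size S' \<le> k"
  shows "confined G k low C'"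
proof -
  have CE: "C \<subseteq> edges G" using conf by (simp add: confined_def)
  have finE: "finite (edges G)" by (rule finite_edges[OF G])
  have finC: "finite {e \<in> C. x \<in> e}" for x using CE finE by (simp add: finite_subset)
  obtain C0 where C0: "C0 \<subseteq> edges G" "card (frontier G C0) < k" "low C0"
    and few: "\<And>x. \<lbrakk>dirty C0 x; degree G x \<ge> 3\<rbrakk> \<Longrightarrow> card {e \<in> C. x \<in> e} \<le> 1"
    and C0_eq: "card (frontier G C) < k \<Longrightarrow> C0 = C"
  proof (cases "card (frontier G C) < k")
    case True
    show ?thesis
    proof (rule that[of C])
      show "low C" "C \<subseteq> edges G" using True conf by (auto simp: confined_def)
      show "card {e \<in> C. x \<in> e} \<le> 1" if "dirty C x" for x
      proof -
        have "{e \<in> C. x \<in> e} = {}" using that by (auto simp: dirty_def)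
        then show ?thesis by (simp only: card.empty)
      qed
    qed (use True in auto)
  next
    case False
    then show ?thesis using conf that unfolding confined_def by blast
  qed
  note C' = step_contained(2)[OF st]
  have new: "C' \<subseteq> C \<or> (\<exists>u v. a = Move u v \<and> {u, v} \<in> edges G \<and> u \<in># S \<and> {u, v} \<notin> C \<and>
      clears G (S, C) u v \<and> C' \<subseteq> insert {u, v} C)"
    using C' legal by (cases a) (auto split: if_splits)
  then obtain e0 where e0: "e0 \<in> edges G \<or> C' \<subseteq> C" "C' \<subseteq> insert e0 C" by blast
  have C'E: "C' \<subseteq> edges G" using e0 CE by blast
  \<comment> \<open>Two clear edges are too few for a vertex of degree at least 3 to be clean.\<close>
  have two: "card {e \<in> C'. x \<in> e} \<le> 2" if "dirty C0 x" "degree G x \<ge> 3" for x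
  proof -
    have "card {e \<in> C'. x \<in> e} \<le> card (insert e0 {e \<in> C. x \<in> e})"
      using e0 finC by (intro card_mono) auto
    also have "\<dots> \<le> Suc (card {e \<in> C. x \<in> e})" by (rule card_insert_le_m1[of "Suc _", simplified]) simp
    finally show ?thesis using few[OF that] by simp
  qed
  show ?thesis
  proof (cases "card (frontier G C') < k")
    case True
    have "low C'"
    proof (rule ccontr)
      assume "\<not> low C'"
      then obtain x where x: "dirty C0 x" "clean G C' x" "degree G x \<ge> 3"
        using sep[OF C0(1) C'E C0(2) True C0(3)] by blast
      have "{e \<in> C'. x \<in> e} = {e \<in> edges G. x \<in> e}" using x C'E by (auto simp: clean_def)
      then show False using two[of x] x by (simp add: degree_def)
    qed
    moreover have "card {e \<in> C'. x \<in> e} \<le> 1" if "dirty C' x" for x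
    proof -
      have "{e \<in> C'. x \<in> e} = {}" using that by (auto simp: dirty_def)
      then show ?thesis by (simp only: card.empty)
    qed
    ultimately show ?thesis using True C'E unfolding confined_def by blast
  next
    case full: False
    have "card {e \<in> C'. x \<in> e} \<le> 1" if x: "dirty C0 x" "degree G x \<ge> 3" for x
      using new
    proof (elim disjE exE conjE)
      assume "C' \<subseteq> C"
      then have "card {e \<in> C'. x \<in> e} \<le> card {e \<in> C. x \<in> e}" by (intro card_mono finC) auto
      then show ?thesis using few[OF x] by simp
    next
      fix u v assume uv: "a = Move u v" "{u, v} \<in> edges G" "u \<in># S" "{u, v} \<notin> C"
        "clears G (S, C) u v" "C' \<subseteq> insert {u, v} C"
      note uvG = simple_graph_edge_verts[OF G uv(2)]
      show ?thesis
      proof (cases "dirty C x")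
        case True
        then have "{e \<in> C'. x \<in> e} \<subseteq> {{u, v}}" using uv(6) by (auto simp: dirty_def)
        then show ?thesis using card_mono[of "{{u, v}}"] by simp
      next
        case False
        then have "\<not> card (frontier G C) < k" using C0_eq x by auto
        then have tight: "k \<le> card (set_mset S)"
          using card_mono[OF _ guard] by simp
        have "\<not> count S u \<ge> 2" using card_set_mset_less_size[of S u] tight size by auto
        then have rest: "\<And>e. \<lbrakk>e \<in> edges G; u \<in> e; e \<noteq> {u, v}\<rbrakk> \<Longrightarrow> e \<in> C"
          using uv(5) by (auto simp: clears_def)
        have S': "S' = add_mset v (S - {#u#})" using step_contained(1)[OF st] uv(1) by simp
        \<comment> \<open>Two searchers on \<open>v\<close> after the move would leave fewer than \<open>k\<close> frontier vertices.\<close>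
        have "k \<le> card (set_mset S')"
          using full card_mono[OF _ frontier_step[OF G st]] by simp
        then have "\<not> count S' v \<ge> 2" using card_set_mset_less_size[of S' v] size' by auto
        then have "v \<notin># S" using S' uvG(3) by (auto simp: count_greater_zero_iff[symmetric] simp del: count_greater_zero_iff)
        then have "v \<notin> frontier G C" using guard by blast
        then have "dirty C v" using uv(2,4) uvG by (auto simp: frontier_def dirty_def)
        then have "x \<noteq> v" using False by blast
        have "x \<noteq> u"
        proof
          assume "x = u"
          have "{e \<in> edges G. u \<in> e} \<subseteq> insert {u, v} {e \<in> C. u \<in> e}" using rest by blast
          then have "degree G u \<le> card (insert {u, v} {e \<in> C. u \<in> e})"
            unfolding degree_def using finC by (intro card_mono) auto
          also have "\<dots> \<le> Suc (card {e \<in> C. u \<in> e})"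
            by (simp add: card_insert_if finC)
          finally show False using few[OF x] x \<open>x = u\<close> by simp
        qed
        have "{e \<in> C'. x \<in> e} \<subseteq> {e \<in> C. x \<in> e}" using uv(6) \<open>x \<noteq> u\<close> \<open>x \<noteq> v\<close> by auto
        then have "card {e \<in> C'. x \<in> e} \<le> card {e \<in> C. x \<in> e}" by (intro card_mono finC)
        then show ?thesis using few[OF x] by simp
      qed
    qed
    then show ?thesis using full C'E C0 unfolding confined_def by blast
  qed
qed

theorem barrier:
  assumes G: "simple_graph G" and k: "0 < k"
    and low: "low {}" and high: "\<not> low (edges G)"
    and sep: "\<And>C0 C1. \<lbrakk>C0 \<subseteq> edges G; C1 \<subseteq> edges G; card (frontier G C0) < k;
        card (frontier G C1) < k; low C0; \<not> low C1\<rbrakk>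
        \<Longrightarrow> \<exists>x. dirty C0 x \<and> clean G C1 x \<and> degree G x \<ge> 3"
  shows "\<not> succeeds G k initial_state as"
proof -
  have "\<not> succeeds G k (S, C) as" if "confined G k low C" "frontier G C \<subseteq> set_mset S" for S C
    using that
  proof (induction as arbitrary: S C)
    case Nil
    show ?case
    proof
      assume "succeeds G k (S, C) []"
      then have "C = edges G" using Nil.prems by (auto simp: confined_def)
      then have "frontier G C = {}" by (auto simp: frontier_def)
      then show False using Nil.prems k high \<open>C = edges G\<close> by (simp add: confined_def)
    qed
  next
    case (Cons a as)
    show ?case
    proof
      assume s: "succeeds G k (S, C) (a # as)"
      obtain S' C' where st: "step G (S, C) a = (S', C')" by fastforce
      have ok: "size S \<le> k" "legal G (S, C) a" "succeeds G k (S', C') as" using s st by auto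
      then have "size S' \<le> k" by (cases as) auto
      then have "confined G k low C'" using confined_step[OF G sep Cons.prems ok(1,2) st] by blast
      then show False using Cons.IH frontier_step[OF G st] ok(3) by blast
    qed
  qed
  moreover have "frontier G {} = {}" by (auto simp: frontier_def)
  moreover have "confined G k low {}"
    using k low \<open>frontier G {} = {}\<close> by (auto simp: confined_def intro!: exI[of _ "{}"])
  ultimately show ?thesis by (simp add: initial_state_def)
qed

lemma succeeds_mono: "succeeds G j s as \<Longrightarrow> j \<le> k \<Longrightarrow> succeeds G k s as"
  by (induction G j s as rule: succeeds.induct) auto

lemma search_number_eqI:
  assumes "succeeds G (Suc k) initial_state as" "\<And>as. \<not> succeeds G k initial_state as"
  shows "search_number G = Suc k"
  unfolding search_number_def
proof (rule Least_equality)
  show "Suc k \<le> j" if "\<exists>as. succeeds G j initial_state as" for j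
    using that assms(2) succeeds_mono[of G j initial_state _ k] by (meson not_less_eq_eq)
qed (use assms in blast)


section \<open>Sweeping a layered graph\<close>

definition winning :: "'a ugraph \<Rightarrow> nat \<Rightarrow> 'a multiset \<Rightarrow> 'a set set \<Rightarrow> bool" where
  "winning G k S C \<longleftrightarrow> (\<exists>as. succeeds G k (S, C) as)"

lemma winning_act:
  assumes "legal G (S, C) a" "size S \<le> k" "act G (S, C) a = (S', C')"
    "frontier G C' \<subseteq> set_mset S'" "winning G k S' C'"
  shows "winning G k S C"
proof -
  obtain as where "succeeds G k (S', C') as" using assms(5) by (auto simp: winning_def)
  then have "succeeds G k (S, C) (a # as)"
    using assms(1-4) by (simp add: step_def recontaminate_guarded)
  then show ?thesis unfolding winning_def by blast
qed

lemma frontier_insert: "frontier G (insert e C) \<subseteq> frontier G C \<union> e"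
  by (auto simp: frontier_def)

lemma winning_place_all:
  assumes "finite D" "finite S" "S \<inter> D = {}" "D \<subseteq> verts G" "card (S \<union> D) \<le> k"
    "frontier G C \<subseteq> S" "winning G k (mset_set (S \<union> D)) C"
  shows "winning G k (mset_set S) C"
  using assms
proof (induction D arbitrary: S rule: finite_induct)
  case (insert v D)
  have "winning G k (mset_set (insert v S)) C"
    by (rule insert.IH) (use insert.prems insert.hyps in auto)
  moreover have "card S < k"
    using insert.prems insert.hyps card_mono[of "S \<union> D" S] by simp
  ultimately show ?case
    using insert.prems by - (rule winning_act[of G _ C "Place v"], auto)
qed simp

text \<open>
  An extra searcher is placed on \<open>u\<close>, crosses to \<open>v\<close> under the first clearing condition, and is
  removed again.
\<close>

lemma winning_clear_edge:
  assumes "finite S" "card S < k" "u \<in> S" "v \<in> S" "{u, v} \<in> edges G" "u \<in> verts G"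
    "frontier G C \<subseteq> S" "winning G k (mset_set S) (insert {u, v} C)"
  shows "winning G k (mset_set S) C"
proof -
  let ?C = "insert {u, v} C"
  have fr: "frontier G ?C \<subseteq> S" using frontier_insert[of G "{u, v}" C] assms by blast
  have "winning G k (add_mset v (mset_set S)) ?C"
    by (rule winning_act[of G _ _ "Remove v"]) (use assms fr in auto)
  then have "winning G k (add_mset u (mset_set S)) C"
    by - (rule winning_act[of G _ _ "Move u v"], (use assms fr in \<open>auto simp: clears_def\<close>))
  then show ?thesis
    by - (rule winning_act[of G _ _ "Place u"], (use assms in auto))
qed

lemma winning_clear_all:
  assumes "simple_graph G" "finite D" "finite S" "card S < k" "D \<subseteq> edges G" "\<Union>D \<subseteq> S"
    "frontier G C \<subseteq> S" "winning G k (mset_set S) (C \<union> D)"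
  shows "winning G k (mset_set S) C"
  using assms(2-)
proof (induction D arbitrary: C rule: finite_induct)
  case (insert e D)
  obtain u v where e: "e = {u, v}"
    using insert.prems assms(1) by (fastforce simp: simple_graph_def card_2_iff)
  have "frontier G (insert e C) \<subseteq> S" using frontier_insert[of G e C] insert.prems by blast
  moreover have "winning G k (mset_set S) (insert e C \<union> D)" using insert.prems(6) by simp
  ultimately have win: "winning G k (mset_set S) (insert e C)"
    using insert.prems(1-4) by - (rule insert.IH, simp_all)
  have uv: "{u, v} \<in> edges G" "u \<in> S" "v \<in> S" using insert.prems(3,4) e by auto
  show ?case
    using winning_clear_edge[OF insert.prems(1,2) uv(2,3,1)
        simple_graph_edge_verts(1)[OF assms(1) uv(1)] insert.prems(5)] win e by simp
qed simp

text \<open>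
  The move uses the second clearing condition: it costs no extra searcher, but gives up \<open>u\<close>.
\<close>

lemma winning_slide:
  assumes G: "simple_graph G" and S: "finite S" "card S \<le> k" "u \<in> S" "v \<notin> S"
    and uv: "{u, v} \<in> edges G"
    and rest: "\<And>e. \<lbrakk>e \<in> edges G; u \<in> e; e \<noteq> {u, v}\<rbrakk> \<Longrightarrow> e \<in> C"
    and fr: "frontier G C \<subseteq> S"
    and fr': "frontier G (insert {u, v} C) \<subseteq> insert v (S - {u})"
    and win: "winning G k (mset_set (insert v (S - {u}))) (insert {u, v} C)"
  shows "winning G k (mset_set S) C"
proof (rule winning_act[of G _ _ "Move u v"])
  show "act G (mset_set S, C) (Move u v) = (mset_set (insert v (S - {u})), insert {u, v} C)"
    using S rest by (auto simp: clears_def mset_set_Diff)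
qed (use S uv fr' win in auto)

lemma winning_slide_all:
  assumes G: "simple_graph G" and "finite U" "finite S" "card S \<le> k" "U \<subseteq> S" "up ` U \<inter> S = {}"
    "inj_on up U" "\<And>u. u \<in> U \<Longrightarrow> {u, up u} \<in> edges G"
    "\<And>u e. \<lbrakk>u \<in> U; e \<in> edges G; u \<in> e; e \<noteq> {u, up u}\<rbrakk> \<Longrightarrow> e \<in> C"
    "frontier G C \<subseteq> S"
    "winning G k (mset_set (S - U \<union> up ` U)) (C \<union> (\<lambda>u. {u, up u}) ` U)"
  shows "winning G k (mset_set S) C"
  using assms(2-)
proof (induction U arbitrary: S C rule: finite_induct)
  case (insert u U)
  let ?S = "insert (up u) (S - {u})" and ?C = "insert {u, up u} C"
  have u: "u \<in> S" "up u \<notin> S" "u \<noteq> up u" using insert.prems by auto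
  have fr: "frontier G ?C \<subseteq> ?S"
  proof -
    have "u \<notin> frontier G ?C" using insert.prems(7)[of u] by (auto simp: frontier_def)
    then show ?thesis using frontier_insert[of G "{u, up u}" C] insert.prems(8) by blast
  qed
  have "winning G k (mset_set ?S) ?C"
  proof (rule insert.IH)
    show "card ?S \<le> k" using u insert.prems(1,2) card_Suc_Diff1[of S u] by (simp add: card_insert_if)
    show "up ` U \<inter> ?S = {}" "U \<subseteq> ?S" using insert.prems insert.hyps by auto
    have "?S - U \<union> up ` U = S - insert u U \<union> up ` insert u U"
      using insert.prems insert.hyps u by auto
    moreover have "?C \<union> (\<lambda>u. {u, up u}) ` U = C \<union> (\<lambda>u. {u, up u}) ` insert u U" by auto
    ultimately show "winning G k (mset_set (?S - U \<union> up ` U)) (?C \<union> (\<lambda>u. {u, up u}) ` U)"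
      using insert.prems(9) by simp
  qed (use insert.prems fr in auto)
  then show ?case
    using insert.prems(1,2,6,8) insert.prems(7)[of u] u fr
    by - (rule winning_slide[OF G, of S k u "up u" C], simp_all)
qed simp

text \<open>
  The sweep passes through the states in which layer \<open>j\<close> is occupied and the clear edges are those
  with both ends in layers up to \<open>j\<close>. From there all searchers slide up, the rest of layer \<open>j + 1\<close>
  is occupied, and the extra searcher clears the edges within it. The proof runs backwards from the
  last layer, since it shows that each of these states can be completed to a successful search.
\<close>

theorem layered_sweep:
  fixes level :: "'a \<Rightarrow> nat"
  assumes G: "simple_graph G" and n: "0 < n"
    and level: "\<And>v. v \<in> verts G \<Longrightarrow> level v < n"
    and width: "\<And>j. j < n \<Longrightarrow> card {v \<in> verts G. level v = j} \<le> w"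
    and up: "\<And>v. \<lbrakk>v \<in> verts G; Suc (level v) < n\<rbrakk> \<Longrightarrow> {v, up v} \<in> edges G \<and> level (up v) = Suc (level v)"
    and inj: "inj_on up (verts G)"
    and edge: "\<And>u v. \<lbrakk>{u, v} \<in> edges G; level u \<le> level v\<rbrakk> \<Longrightarrow> level u = level v \<or> v = up u \<and> level v = Suc (level u)"
  shows "\<exists>as. succeeds G (Suc w) initial_state as"
proof -
  define L where "L j = {v \<in> verts G. level v = j}" for j
  define D where "D j = {e \<in> edges G. \<forall>v\<in>e. level v \<le> j}" for j
  define F where "F j = {e \<in> edges G. e \<subseteq> L j}" for j
  have finE: "finite (edges G)" by (rule finite_edges[OF G])
  have finL: "finite (L j)" for j using G by (simp add: L_def simple_graph_def)
  have finF: "finite (F j)" for j using finE by (simp add: F_def)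
  have edge_cases: "(\<exists>j. \<forall>v\<in>e. v \<in> verts G \<and> level v = j) \<or> (\<exists>u\<in>verts G. e = {u, up u} \<and> up u \<in> verts G \<and> level (up u) = Suc (level u))"
    if e: "e \<in> edges G" for e
  proof -
    obtain u v where uv: "e = {u, v}" "level u \<le> level v"
    proof -
      obtain u v where "e = {u, v}" using e G by (fastforce simp: simple_graph_def card_2_iff)
      then show ?thesis using that[of u v] that[of v u] by (cases "level u \<le> level v") auto
    qed
    then show ?thesis
      using edge[of u v] e simple_graph_edge_verts[OF G, of u v] by (auto simp: L_def)
  qed
  have win: "winning G (Suc w) (mset_set (L j)) (D j)" if "j < n" for j
    using that
  proof (induction "n - Suc j" arbitrary: j)
    case 0
    have "D j = edges G"
    proof -
      have "level v \<le> j" if "e \<in> edges G" "v \<in> e" for e v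
        using that G 0 level[of v] by (fastforce simp: simple_graph_def)
      then show ?thesis by (auto simp: D_def)
    qed
    then have "succeeds G (Suc w) (mset_set (L j), D j) []"
      using width[of j] 0 by (simp add: L_def)
    then show ?case unfolding winning_def by blast
  next
    case (Suc x)
    then have j: "Suc j < n" by simp
    let ?R = "(\<lambda>u. {u, up u}) ` L j"
    have up_j: "{u, up u} \<in> edges G" "up u \<in> L (Suc j)" if "u \<in> L j" for u
    proof -
      have u: "{u, up u} \<in> edges G" "level (up u) = Suc j"
        using that up[of u] j by (simp_all add: L_def)
      then show "{u, up u} \<in> edges G" "up u \<in> L (Suc j)"
        using simple_graph_edge_verts(2)[OF G u(1)] by (simp_all add: L_def)
    qed
    have D_Suc: "D (Suc j) = D j \<union> ?R \<union> F (Suc j)"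
    proof
      show "D (Suc j) \<subseteq> D j \<union> ?R \<union> F (Suc j)"
      proof
        fix e assume e: "e \<in> D (Suc j)"
        then have eE: "e \<in> edges G" by (simp add: D_def)
        from edge_cases[OF eE] show "e \<in> D j \<union> ?R \<union> F (Suc j)"
        proof (elim disjE exE bexE conjE)
          fix i assume i: "\<forall>v\<in>e. v \<in> verts G \<and> level v = i"
          moreover obtain v where "v \<in> e" using edge_nonempty[OF G eE] by blast
          ultimately have "i \<le> Suc j" using e by (auto simp: D_def L_def)
          then show ?thesis using i e by (cases "i = Suc j") (auto simp: D_def F_def L_def)
        next
          fix u assume u: "u \<in> verts G" "e = {u, up u}" "level (up u) = Suc (level u)"
          then have "level u \<le> j" using e by (auto simp: D_def)
          then show ?thesis using u e by (cases "level u = j") (auto simp: D_def L_def)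
        qed
      qed
      show "D j \<union> ?R \<union> F (Suc j) \<subseteq> D (Suc j)"
        using up_j by (auto simp: D_def F_def L_def)
    qed
    have other: "e \<in> D j" if "e \<in> edges G" "v \<in> e" "level v \<le> j" "e \<notin> ?R" for e v
      using edge_cases[OF that(1)] that by (auto simp: D_def L_def)
    have fr0: "frontier G (D j) \<subseteq> L j"
    proof
      fix v assume v: "v \<in> frontier G (D j)"
      then have lv: "level v \<le> j" "v \<in> verts G" by (auto simp: frontier_def D_def)
      obtain f where f: "f \<in> edges G - D j" "v \<in> f" using v by (auto simp: frontier_def)
      then obtain u where "u \<in> L j" "f = {u, up u}" using other[of f v] lv by blast
      then show "v \<in> L j" using f lv up_j(2)[of u] by (auto simp: L_def)
    qed
    have fr1: "frontier G (D j \<union> ?R) \<subseteq> up ` L j"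
    proof
      fix v assume v: "v \<in> frontier G (D j \<union> ?R)"
      then obtain e f where e: "e \<in> D j \<union> ?R" "v \<in> e" and f: "f \<in> edges G" "f \<notin> D j \<union> ?R" "v \<in> f"
        by (auto simp: frontier_def)
      then have "\<not> level v \<le> j" using other[of f v] by blast
      then show "v \<in> up ` L j" using e by (auto simp: D_def L_def)
    qed
    have w: "card (L i) \<le> w" if "i < n" for i using width[OF that] by (simp add: L_def)
    have "winning G (Suc w) (mset_set (L (Suc j))) (D (Suc j))"
      using Suc j by (intro Suc.hyps(1)) auto
    then have "winning G (Suc w) (mset_set (L (Suc j))) (D j \<union> ?R)"
      using w[OF j] fr1 up_j(2) unfolding D_Suc
      by - (rule winning_clear_all[OF G finF finL], auto simp: F_def)
    then have "winning G (Suc w) (mset_set (up ` L j)) (D j \<union> ?R)"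
      using w[OF j] fr1 up_j(2) finL
      by - (rule winning_place_all[of "L (Suc j) - up ` L j"], auto simp: Un_absorb1 image_subset_iff L_def)
    then have slid: "winning G (Suc w) (mset_set (L j - L j \<union> up ` L j)) (D j \<union> ?R)" by simp
    show ?case
    proof (rule winning_slide_all[OF G finL finL _ order.refl _ _ _ _ fr0 slid])
      show "card (L j) \<le> Suc w" using w[of j] j by simp
      show "up ` L j \<inter> L j = {}" using up_j(2) by (fastforce simp: L_def)
      show "inj_on up (L j)" by (rule inj_on_subset[OF inj]) (auto simp: L_def)
      show "{u, up u} \<in> edges G" if "u \<in> L j" for u using up_j(1)[OF that] .
      show "e \<in> D j" if "u \<in> L j" "e \<in> edges G" "u \<in> e" "e \<noteq> {u, up u}" for u e
      proof (rule other[OF that(2,3)])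
        show "level u \<le> j" using that(1) by (simp add: L_def)
        show "e \<notin> ?R"
        proof
          assume "e \<in> ?R"
          then obtain u' where "u' \<in> L j" "e = {u', up u'}" by blast
          then show False using that(1,3,4) up_j(2)[of u'] by (auto simp: L_def)
        qed
      qed
    qed
  qed
  have "winning G (Suc w) (mset_set (L 0)) (D 0)" using win n by simp
  moreover have "D 0 = F 0"
    using G by (auto simp: D_def F_def L_def simple_graph_def)
  moreover have fr: "frontier G {} = {}" by (auto simp: frontier_def)
  moreover have w0: "card (L 0) \<le> w" using width n by (simp add: L_def)
  ultimately have "winning G (Suc w) (mset_set (L 0)) {}"
    by - (rule winning_clear_all[OF G finF finL, of 0], auto simp: F_def)
  then have "winning G (Suc w) (mset_set {}) {}"
    using w0 fr by - (rule winning_place_all[OF finL[of 0]], simp_all add: L_def)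
  then show ?thesis by (simp add: winning_def initial_state_def)
qed

section \<open>Products with paths\<close>

lemma product_edge_iff:
  "{(g, h), (g', h')} \<in> edges (cartesian_product G H) \<longleftrightarrow>
     (g, h) \<in> verts G \<times> verts H \<and> (g', h') \<in> verts G \<times> verts H \<and>
     (g = g' \<and> {h, h'} \<in> edges H \<or> h = h' \<and> {g, g'} \<in> edges G)"
  by (auto simp: cartesian_product_def doubleton_eq_iff insert_commute)

lemma product_verts: "verts (cartesian_product G H) = verts G \<times> verts H"
  by (simp add: cartesian_product_def)

lemma path_verts: "verts (path_graph n) = {..<n}"
  by (simp add: path_graph_def)

lemma path_edge_iff: "{i, j} \<in> edges (path_graph n) \<longleftrightarrow> (j = Suc i \<or> i = Suc j) \<and> i < n \<and> j < n"
  by (auto simp: path_graph_def doubleton_eq_iff)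

lemma complete_verts: "verts (complete_graph m) = {..<m}"
  by (simp add: complete_graph_def)

lemma complete_edge_iff: "{i, j} \<in> edges (complete_graph m) \<longleftrightarrow> i \<noteq> j \<and> i < m \<and> j < m"
  by (auto simp: complete_graph_def doubleton_eq_iff)

lemmas product_path_simps =
  product_edge_iff product_verts path_verts path_edge_iff complete_verts complete_edge_iff

lemma product_path_sweep:
  assumes X: "simple_graph X" and n: "0 < n"
  shows "\<exists>as. succeeds (cartesian_product X (path_graph n)) (Suc (card (verts X))) initial_state as"
proof (rule layered_sweep[where level = snd and up = "\<lambda>(x, j). (x, Suc j)" and n = n])
  show "simple_graph (cartesian_product X (path_graph n))"
    by (intro simple_graph_cartesian_product X simple_graph_path_graph)
  show "card {v \<in> verts (cartesian_product X (path_graph n)). snd v = j} \<le> card (verts X)" if "j < n" for j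
  proof -
    have "{v \<in> verts (cartesian_product X (path_graph n)). snd v = j} = verts X \<times> {j}"
      using that by (auto simp: product_path_simps)
    then show ?thesis by (simp add: card_cartesian_product)
  qed
  show "snd u = snd v \<or> v = (case u of (x, j) \<Rightarrow> (x, Suc j)) \<and> snd v = Suc (snd u)"
    if "{u, v} \<in> edges (cartesian_product X (path_graph n))" "snd u \<le> snd v" for u v
    using that by (cases u; cases v) (auto simp: product_path_simps)
qed (use n in \<open>auto simp: product_path_simps inj_on_def\<close>)

lemma path_product_sweep:
  assumes X: "simple_graph X" and n: "0 < n"
  shows "\<exists>as. succeeds (cartesian_product (path_graph n) X) (Suc (card (verts X))) initial_state as"
proof (rule layered_sweep[where level = fst and up = "\<lambda>(j, x). (Suc j, x)" and n = n])
  show "simple_graph (cartesian_product (path_graph n) X)"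
    by (intro simple_graph_cartesian_product X simple_graph_path_graph)
  show "card {v \<in> verts (cartesian_product (path_graph n) X). fst v = j} \<le> card (verts X)" if "j < n" for j
  proof -
    have "{v \<in> verts (cartesian_product (path_graph n) X). fst v = j} = {j} \<times> verts X"
      using that by (auto simp: product_path_simps)
    then show ?thesis by (simp add: card_cartesian_product)
  qed
  show "fst u = fst v \<or> v = (case u of (j, x) \<Rightarrow> (Suc j, x)) \<and> fst v = Suc (fst u)"
    if "{u, v} \<in> edges (cartesian_product (path_graph n) X)" "fst u \<le> fst v" for u v
    using that by (cases u; cases v) (auto simp: product_path_simps)
qed (use n in \<open>auto simp: product_path_simps inj_on_def\<close>)

section \<open>Clean and dirty lines\<close>

lemma clean_or_dirty:
  assumes "C \<subseteq> edges G" "v \<in> verts G" "v \<notin> frontier G C"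
  shows "clean G C v \<or> dirty C v"
  using assms by (auto simp: clean_def dirty_def frontier_def)

lemma clean_adjacent_not_dirty: "{u, v} \<in> edges G \<Longrightarrow> clean G C u \<Longrightarrow> \<not> dirty C v"
  by (auto simp: clean_def dirty_def)

lemma clean_not_dirty: "{u, v} \<in> edges G \<Longrightarrow> clean G C u \<Longrightarrow> \<not> dirty C u"
  by (auto simp: clean_def dirty_def)

text \<open>
  Adjacent vertices off the frontier are both clean or both dirty, as the edge between them is clear
  or not; so the type can only change along a path at a frontier vertex.
\<close>

lemma frontier_between:
  assumes C: "C \<subseteq> edges G" and "a \<le> b"
    and edge: "\<And>i. a \<le> i \<Longrightarrow> i < b \<Longrightarrow> {f i, f (Suc i)} \<in> edges G"
    and vert: "\<And>i. a \<le> i \<Longrightarrow> i \<le> b \<Longrightarrow> f i \<in> verts G"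
    and differ: "clean G C (f a) \<noteq> clean G C (f b)"
  shows "\<exists>i\<in>{a..b}. f i \<in> frontier G C"
proof (rule ccontr)
  assume no: "\<not> ?thesis"
  have "clean G C (f i) = clean G C (f a)" if "a \<le> i" "i \<le> b" for i
    using that
  proof (induction i rule: dec_induct)
    case (step i)
    then have e: "{f i, f (Suc i)} \<in> edges G" "{f (Suc i), f i} \<in> edges G"
      using edge[of i] by (simp_all add: insert_commute)
    have "clean G C (f k) \<or> dirty C (f k)" if "a \<le> k" "k \<le> b" for k
      using clean_or_dirty[OF C vert] no that by simp
    then have "clean G C (f i) \<or> dirty C (f i)" "clean G C (f (Suc i)) \<or> dirty C (f (Suc i))"
      using step.hyps step.prems by (meson Suc_leD le_SucI)+
    then show ?case
      using step clean_adjacent_not_dirty[OF e(1)] clean_adjacent_not_dirty[OF e(2)] by auto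
  qed simp
  then show False using differ \<open>a \<le> b\<close> by blast
qed

lemma line_uniform:
  assumes C: "C \<subseteq> edges G"
    and edge: "\<And>i. Suc i < N \<Longrightarrow> {f i, f (Suc i)} \<in> edges G"
    and vert: "\<And>i. i < N \<Longrightarrow> f i \<in> verts G"
    and free: "\<And>i. i < N \<Longrightarrow> f i \<notin> frontier G C"
  shows "(\<forall>i<N. clean G C (f i)) \<or> (\<forall>i<N. dirty C (f i))"
proof -
  have "clean G C (f i) = clean G C (f 0)" if "i < N" for i
    using frontier_between[OF C, of 0 i f] that edge vert free by fastforce
  then show ?thesis using clean_or_dirty[OF C] vert free by blast
qed

lemma free_line:
  assumes "finite M" "card M < m"
  shows "\<exists>i<m. \<forall>x\<in>M. f x \<noteq> i"
proof (rule ccontr)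
  assume "\<not> ?thesis"
  then have "{..<m} \<subseteq> f ` M" by blast
  then have "m \<le> card (f ` M)" using card_mono[of "f ` M" "{..<m}"] assms by simp
  then show False using card_image_le[OF assms(1), of f] assms by simp
qed

lemma three_le_degree:
  assumes G: "simple_graph G"
    and e: "{x, a} \<in> edges G" "{x, b} \<in> edges G" "{x, c} \<in> edges G"
    and ne: "a \<noteq> b" "a \<noteq> c" "b \<noteq> c"
  shows "3 \<le> degree G x"
proof -
  have "card {{x, a}, {x, b}, {x, c}} = 3" using ne by (simp add: doubleton_eq_iff card_insert_if)
  moreover have "card {{x, a}, {x, b}, {x, c}} \<le> card {e \<in> edges G. x \<in> e}"
    using e finite_edges[OF G] by (intro card_mono) auto
  ultimately show ?thesis by (simp add: degree_def)
qed

section \<open>Complete graph times path\<close>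

text \<open>
  A fibre over the complete graph (a copy of the path) that avoids the frontier is clean or dirty as
  a whole. A dirty fibre meets every clique, so no vertex at all is clean; likewise a clean fibre
  excludes dirty vertices. Therefore every vertex outside the two frontiers is dirty in the low
  state and clean in the high one, and the frontiers together are too small to cover the graph.
\<close>

lemma complete_path_separation:
  fixes m n :: nat
  defines "G \<equiv> cartesian_product (complete_graph m) (path_graph n)"
  defines "low \<equiv> \<lambda>C. \<exists>i<m. \<forall>j<n. dirty C (i, j)"
  assumes m: "3 \<le> m" and n: "2 \<le> n"
    and C: "C0 \<subseteq> edges G" "C1 \<subseteq> edges G"
    and fr: "card (frontier G C0) < m" "card (frontier G C1) < m"
    and low: "low C0" "\<not> low C1"
  shows "\<exists>x. dirty C0 x \<and> clean G C1 x \<and> 3 \<le> degree G x"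
proof -
  have G: "simple_graph G"
    unfolding G_def by (intro simple_graph_cartesian_product simple_graph_complete_graph simple_graph_path_graph)
  have V: "verts G = {..<m} \<times> {..<n}" by (simp add: G_def product_path_simps)
  have row: "{(i, j), (i', j)} \<in> edges G" if "i < m" "i' < m" "i \<noteq> i'" "j < n" for i i' j
    using that by (simp add: G_def product_path_simps)
  have fibre: "{(i, j), (i, Suc j)} \<in> edges G" if "i < m" "Suc j < n" for i j
    using that by (simp add: G_def product_path_simps)
  obtain i1 where i1: "i1 < m" "\<forall>x\<in>frontier G C1. fst x \<noteq> i1"
    using free_line[OF finite_frontier[OF G] fr(2), of fst] by blast
  have "(\<forall>j<n. clean G C1 (i1, j)) \<or> (\<forall>j<n. dirty C1 (i1, j))"
    using i1 fibre V by (intro line_uniform[OF C(2), of n "\<lambda>j. (i1, j)"]) auto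
  then have clean1: "\<forall>j<n. clean G C1 (i1, j)" using low i1 by (auto simp: low_def)
  obtain i0 where i0: "i0 < m" "\<forall>j<n. dirty C0 (i0, j)" using low by (auto simp: low_def)
  have fin: "finite (frontier G C)" for C by (rule finite_frontier[OF G])
  have "card (frontier G C0 \<union> frontier G C1) < card (verts G)"
  proof -
    have "card (frontier G C0 \<union> frontier G C1) < m * 2"
      using card_Un_le[of "frontier G C0" "frontier G C1"] fr by simp
    also have "\<dots> \<le> m * n" using n by simp
    finally show ?thesis by (simp add: V card_cartesian_product)
  qed
  then obtain x where x: "x \<in> verts G" "x \<notin> frontier G C0" "x \<notin> frontier G C1"
    using card_mono[of "frontier G C0 \<union> frontier G C1" "verts G"] fin by fastforce
  obtain i j where ij: "x = (i, j)" "i < m" "j < n" using x V by auto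
  have "dirty C0 x"
  proof (cases "i = i0")
    case False
    then have "\<not> clean G C0 x"
      using clean_adjacent_not_dirty[OF row[of i i0 j]] i0 ij by blast
    then show ?thesis using clean_or_dirty[OF C(1)] x by blast
  qed (use i0 ij in simp)
  moreover have "clean G C1 x"
  proof (cases "i = i1")
    case False
    then have "\<not> dirty C1 x"
      using clean_adjacent_not_dirty[OF row[of i1 i j]] clean1 i1 ij by blast
    then show ?thesis using clean_or_dirty[OF C(2)] x by blast
  qed (use clean1 ij in simp)
  moreover have "3 \<le> degree G x"
  proof -
    \<comment> \<open>two clique neighbours besides a path neighbour\<close>
    define a where "a = (if i = 0 then 1 else 0::nat)"
    define b where "b = (if i \<le> 1 then 2 else 1::nat)"
    have ab: "a < m" "b < m" "a \<noteq> i" "b \<noteq> i" "a \<noteq> b" using m by (auto simp: a_def b_def)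
    obtain j' where "{x, (i, j')} \<in> edges G"
    proof (cases "Suc j < n")
      case True
      then show ?thesis using fibre ij that by blast
    next
      case False
      then have "{(i, j - 1), (i, Suc (j - 1))} \<in> edges G" "Suc (j - 1) = j"
        using fibre[of i "j - 1"] ij n by auto
      then show ?thesis using that[of "j - 1"] ij by (simp add: insert_commute)
    qed
    then show ?thesis
      using three_le_degree[OF G, of x "(a, j)" "(b, j)" "(i, j')"] row[of i a j] row[of i b j] ab ij by auto
  qed
  ultimately show ?thesis by blast
qed

section \<open>Grids\<close>

text \<open>
  Suppose that the vertices dirty in the low state and clean in the high state all have degree at
  most 2, that is, are corners. The low state has a dirty row \<open>r\<close> and a dirty column \<open>c\<close>, the high
  state a clean row \<open>r'\<close> and a clean column \<open>c'\<close>. So \<open>r\<close> and \<open>c'\<close> cross in a corner, and so do \<open>r'\<close>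
  and \<open>c\<close>; moreover a row cannot be dirty in the one state and clean in the other, since its second
  vertex is no corner. So \<open>r\<close> and \<open>r'\<close> are the two outer rows, and \<open>r\<close> is the only dirty row of the
  low state; the same holds for columns. Hence all rows except \<open>r\<close> and all columns
  except \<open>c\<close> meet the frontier of the low state, which has fewer than \<open>min m n\<close> vertices: the grid
  is square and each of these rows contains exactly one frontier vertex.

  The contradiction comes from the row \<open>q\<close> next to \<open>r\<close>. In the low state its vertices are adjacent
  to dirty ones, so all but one of them are dirty. In the high state every vertex of \<open>q\<close> that is not
  clean has a frontier vertex in its column on the way to the clean row \<open>r'\<close>. These lie in different
  columns and outside \<open>r\<close>, which contains a further frontier vertex, so there are at most \<open>m - 2\<close> of
  them. Thus some vertex of \<open>q\<close> is dirty in the low state and clean in the high one.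
\<close>

lemma grid_separation:
  fixes m n :: nat
  defines "G \<equiv> cartesian_product (path_graph m) (path_graph n)"
  defines "low \<equiv> \<lambda>C. \<exists>i<m. \<forall>j<n. dirty C (i, j)"
  assumes m: "3 \<le> m" and n: "3 \<le> n"
    and C: "C0 \<subseteq> edges G" "C1 \<subseteq> edges G"
    and fr: "card (frontier G C0) < min m n" "card (frontier G C1) < min m n"
    and low: "low C0" "\<not> low C1"
  shows "\<exists>x. dirty C0 x \<and> clean G C1 x \<and> 3 \<le> degree G x"
proof (rule ccontr)
  assume no: "\<not> ?thesis"
  have G: "simple_graph G"
    unfolding G_def by (intro simple_graph_cartesian_product simple_graph_path_graph)
  have V: "verts G = {..<m} \<times> {..<n}" by (simp add: G_def product_path_simps)
  have vertical: "{(i, j), (Suc i, j)} \<in> edges G" if "Suc i < m" "j < n" for i j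
    using that by (simp add: G_def product_path_simps)
  have horizontal: "{(i, j), (i, Suc j)} \<in> edges G" if "i < m" "Suc j < n" for i j
    using that by (simp add: G_def product_path_simps)
  have fin: "finite (frontier G C)" for C by (rule finite_frontier[OF G])

  have row_uniform: "(\<forall>j<n. clean G C (i, j)) \<or> (\<forall>j<n. dirty C (i, j))"
    if "C \<subseteq> edges G" "i < m" "\<forall>x\<in>frontier G C. fst x \<noteq> i" for C i
    using that horizontal V by (intro line_uniform[of C G n "\<lambda>j. (i, j)"]) auto
  have col_uniform: "(\<forall>i<m. clean G C (i, j)) \<or> (\<forall>i<m. dirty C (i, j))"
    if "C \<subseteq> edges G" "j < n" "\<forall>x\<in>frontier G C. snd x \<noteq> j" for C j
    using that vertical V by (intro line_uniform[of C G m "\<lambda>i. (i, j)"]) auto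
  have not_both: "\<not> (clean G C (i, j) \<and> dirty C (i, j))" if "i < m" "j < n" for C i j
  proof (cases "Suc j < n")
    case True
    then show ?thesis using clean_not_dirty[OF horizontal] that by blast
  next
    case False
    then have "{(i, j), (i, j - 1)} \<in> edges G"
      using horizontal[of i "j - 1"] that n by (simp add: insert_commute)
    then show ?thesis using clean_not_dirty[of "(i, j)"] by blast
  qed

  have corner: "(i = 0 \<or> i = m - 1) \<and> (j = 0 \<or> j = n - 1)"
    if "i < m" "j < n" "dirty C0 (i, j)" "clean G C1 (i, j)" for i j
  proof (rule ccontr)
    assume "\<not> ?thesis"
    then have "0 < i \<and> Suc i < m \<or> 0 < j \<and> Suc j < n" using that(1,2) by auto
    then consider "0 < i" "Suc i < m" | "0 < j" "Suc j < n" by blast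
    then have "3 \<le> degree G (i, j)"
    proof cases
      case 1
      then have v: "{(i, j), (i - 1, j)} \<in> edges G" "{(i, j), (Suc i, j)} \<in> edges G"
        using vertical[of "i - 1" j] vertical[of i j] that by (simp_all add: insert_commute)
      show ?thesis
      proof (cases "j = 0")
        case True
        then have "{(i, j), (i, Suc j)} \<in> edges G" using horizontal that n by simp
        from three_le_degree[OF G v this] show ?thesis by (cases i) simp_all
      next
        case False
        then have "{(i, j), (i, j - 1)} \<in> edges G"
          using horizontal[of i "j - 1"] that by (simp add: insert_commute)
        from three_le_degree[OF G v this] show ?thesis using False by (cases i) simp_all
      qed
    next
      case 2
      then have h: "{(i, j), (i, j - 1)} \<in> edges G" "{(i, j), (i, Suc j)} \<in> edges G"
        using horizontal[of i "j - 1"] horizontal[of i j] that by (simp_all add: insert_commute)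
      show ?thesis
      proof (cases "i = 0")
        case True
        then have "{(i, j), (Suc i, j)} \<in> edges G" using vertical that m by simp
        from three_le_degree[OF G h this] show ?thesis by (cases j) simp_all
      next
        case False
        then have "{(i, j), (i - 1, j)} \<in> edges G"
          using vertical[of "i - 1" j] that by (simp add: insert_commute)
        from three_le_degree[OF G h this] show ?thesis using False by (cases j) simp_all
      qed
    qed
    then show False using no that by blast
  qed

  obtain r where r: "r < m" "\<forall>j<n. dirty C0 (r, j)" using low by (auto simp: low_def)
  obtain c where c: "c < n" "\<forall>x\<in>frontier G C0. snd x \<noteq> c"
    using free_line[OF fin, of C0 n snd] fr by auto
  have c_dirty: "\<forall>i<m. dirty C0 (i, c)"
    using col_uniform[OF C(1) c] r not_both[of r c] c by blast
  obtain r' where r': "r' < m" "\<forall>x\<in>frontier G C1. fst x \<noteq> r'"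
    using free_line[OF fin, of C1 m fst] fr by auto
  have r'_clean: "\<forall>j<n. clean G C1 (r', j)"
    using row_uniform[OF C(2) r'] low(2) r' by (auto simp: low_def)
  obtain c' where c': "c' < n" "\<forall>x\<in>frontier G C1. snd x \<noteq> c'"
    using free_line[OF fin, of C1 n snd] fr by auto
  have c'_clean: "\<forall>i<m. clean G C1 (i, c')"
    using col_uniform[OF C(2) c'] r'_clean not_both[of r' c'] c' r' by blast

  have rows: "{i, i'} = {0, m - 1}"
    if "i < m" "i' < m" "\<forall>j<n. dirty C0 (i, j)" "\<forall>j<n. clean G C1 (i', j)" for i i'
  proof -
    have "i \<noteq> i'" using corner[of i 1] that n by auto
    moreover have "i = 0 \<or> i = m - 1" using corner[of i c'] that c' c'_clean by blast
    moreover have "i' = 0 \<or> i' = m - 1" using corner[of i' c] that c c_dirty by blast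
    ultimately show ?thesis by auto
  qed
  have cols: "{j, j'} = {0, n - 1}"
    if "j < n" "j' < n" "\<forall>i<m. dirty C0 (i, j)" "\<forall>i<m. clean G C1 (i, j')" for j j'
  proof -
    have "j \<noteq> j'" using corner[of 1 j] that m by auto
    moreover have "j = 0 \<or> j = n - 1" using corner[of r' j] that r' r'_clean by blast
    moreover have "j' = 0 \<or> j' = n - 1" using corner[of r j'] that r by blast
    ultimately show ?thesis by auto
  qed
  have rr': "{r, r'} = {0, m - 1}" using rows[OF r(1) r'(1) r(2) r'_clean] .
  have cc': "{c, c'} = {0, n - 1}" using cols[OF c(1) c'(1) c_dirty c'_clean] .

  have hit_rows: "{..<m} - {r} \<subseteq> fst ` frontier G C0"
  proof
    fix i assume i: "i \<in> {..<m} - {r}"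
    show "i \<in> fst ` frontier G C0"
    proof (rule ccontr)
      assume "i \<notin> fst ` frontier G C0"
      then have "\<forall>x\<in>frontier G C0. fst x \<noteq> i" by auto
      then have "\<forall>j<n. dirty C0 (i, j)"
        using row_uniform[OF C(1)] i c_dirty not_both[of i c] c by blast
      then have "{i, r'} = {0, m - 1}" using rows[of i r'] i r'(1) r'_clean by simp
      then show False using rr' i by (auto simp: doubleton_eq_iff)
    qed
  qed
  have hit_cols: "{..<n} - {c} \<subseteq> snd ` frontier G C0"
  proof
    fix j assume j: "j \<in> {..<n} - {c}"
    show "j \<in> snd ` frontier G C0"
    proof (rule ccontr)
      assume "j \<notin> snd ` frontier G C0"
      then have "\<forall>x\<in>frontier G C0. snd x \<noteq> j" by auto
      then have "\<forall>i<m. dirty C0 (i, j)"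
        using col_uniform[OF C(1)] j r not_both[of r j] by blast
      then have "{j, c'} = {0, n - 1}" using cols[of j c'] j c'(1) c'_clean by simp
      then show False using cc' j by (auto simp: doubleton_eq_iff)
    qed
  qed
  have r_hit: "r \<in> fst ` frontier G C1"
  proof (rule ccontr)
    assume "r \<notin> fst ` frontier G C1"
    then have "\<forall>x\<in>frontier G C1. fst x \<noteq> r" by auto
    then have "\<forall>j<n. clean G C1 (r, j)"
      using row_uniform[OF C(2) r(1)] c' c'_clean not_both[of r c'] r by blast
    then have "{r, r} = {0, m - 1}" using rows[of r r] r by simp
    then show False using m by (auto simp: doubleton_eq_iff)
  qed

  have m_le: "m - 1 \<le> card (fst ` frontier G C0)"
    using card_mono[OF _ hit_rows] fin r by simp
  have n_le: "n - 1 \<le> card (snd ` frontier G C0)"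
    using card_mono[OF _ hit_cols] fin c by simp
  have mn: "m = n" "card (frontier G C0) = m - 1" "card (fst ` frontier G C0) = m - 1"
    using m_le n_le card_image_le[OF fin, of fst C0] card_image_le[OF fin, of snd C0] fr m n by auto
  have inj: "inj_on fst (frontier G C0)"
    using mn by (intro eq_card_imp_inj_on fin) simp

  define q where "q = (if r = 0 then 1 else m - 2)"
  have q: "0 < q" "Suc q < m" "q \<noteq> r" using m rr' by (auto simp: q_def doubleton_eq_iff)
  have adj: "{(q, j), (r, j)} \<in> edges G" if "j < n" for j
  proof (cases "r = 0")
    case True
    then show ?thesis using vertical[of 0 j] that m by (simp add: q_def insert_commute)
  next
    case False
    then have "r = m - 1" using rr' by (auto simp: doubleton_eq_iff)
    then show ?thesis
      using False vertical[of "m - 2" j] that m by (simp add: q_def numeral_2_eq_2 Suc_diff_Suc)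
  qed
  let ?N0 = "{j. j < n \<and> \<not> dirty C0 (q, j)}" and ?N1 = "{j. j < n \<and> \<not> clean G C1 (q, j)}"
  have "card ?N0 \<le> 1"
  proof -
    have front: "(q, j) \<in> frontier G C0" if "j \<in> ?N0" for j
    proof (rule ccontr)
      assume "(q, j) \<notin> frontier G C0"
      then have "clean G C0 (q, j)" using clean_or_dirty[OF C(1), of "(q, j)"] that q V by auto
      then show False using clean_adjacent_not_dirty[OF adj] that r by blast
    qed
    have "j = j'" if "j \<in> ?N0" "j' \<in> ?N0" for j j'
      using inj_onD[OF inj, of "(q, j)" "(q, j')"] front that by auto
    then show ?thesis by (simp add: card_le_Suc0_iff_eq)
  qed
  moreover have "card ?N1 < m - 1"
  proof -
    have "?N1 \<subseteq> snd ` {x \<in> frontier G C1. fst x \<noteq> r}"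
    proof
      fix j assume j: "j \<in> ?N1"
      let ?a = "min q r'" and ?b = "max q r'"
      have "\<exists>i\<in>{?a..?b}. (i, j) \<in> frontier G C1"
      proof (rule frontier_between[OF C(2), of _ _ "\<lambda>i. (i, j)"])
        show "clean G C1 (?a, j) \<noteq> clean G C1 (?b, j)"
          using j r'_clean by (auto simp: min_def max_def)
      qed (use j q r' V vertical in auto)
      then obtain i where i: "?a \<le> i" "i \<le> ?b" "(i, j) \<in> frontier G C1" by auto
      then have "i \<noteq> r" using rr' q by (auto simp: doubleton_eq_iff min_def max_def split: if_splits)
      then show "j \<in> snd ` {x \<in> frontier G C1. fst x \<noteq> r}" using i by force
    qed
    then have "card ?N1 \<le> card (snd ` {x \<in> frontier G C1. fst x \<noteq> r})"
      using fin by (intro card_mono) simp_all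
    also have "\<dots> \<le> card {x \<in> frontier G C1. fst x \<noteq> r}" using fin by (intro card_image_le) simp
    also have "\<dots> < card (frontier G C1)" using r_hit fin by (intro psubset_card_mono) auto
    finally show ?thesis using fr mn by simp
  qed
  ultimately have "card (?N0 \<union> ?N1) < n"
    using card_Un_le[of ?N0 ?N1] mn by linarith
  then obtain j where "j < n" "j \<notin> ?N0 \<union> ?N1"
    using free_line[of "?N0 \<union> ?N1" n "\<lambda>j. j"] by auto
  then show False using corner[of q j] q by auto
qed

section \<open>The search numbers\<close>

theorem theorem5:
  fixes m n :: nat
  assumes "m \<ge> 3" and "n \<ge> 3"
  shows "search_number (cartesian_product (path_graph m) (path_graph n)) = min m n + 1 \<and>
         search_number (cartesian_product (complete_graph m) (path_graph n)) = m + 1"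
proof
  let ?G = "cartesian_product (path_graph m) (path_graph n)"
  have "\<exists>as. succeeds ?G (Suc (min m n)) initial_state as"
    using product_path_sweep[OF simple_graph_path_graph, of n m]
      path_product_sweep[OF simple_graph_path_graph, of m n] assms
    by (auto simp: min_def path_verts)
  then obtain as where "succeeds ?G (Suc (min m n)) initial_state as" by blast
  moreover have "\<not> succeeds ?G (min m n) initial_state as" for as
  proof (rule barrier[where low = "\<lambda>C. \<exists>i<m. \<forall>j<n. dirty C (i, j)"])
    show "simple_graph ?G" by (intro simple_graph_cartesian_product simple_graph_path_graph)
    show "\<not> (\<exists>i<m. \<forall>j<n. dirty (edges ?G) (i, j))"
    proof
      assume "\<exists>i<m. \<forall>j<n. dirty (edges ?G) (i, j)"
      then obtain i where "i < m" "dirty (edges ?G) (i, 0)" using assms by auto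
      moreover have "{(i, 0), (i, Suc 0)} \<in> edges ?G"
        using \<open>i < m\<close> assms by (simp add: product_path_simps)
      ultimately show False by (auto simp: dirty_def)
    qed
    show "\<exists>i<m. \<forall>j<n. dirty {} (i, j)" using assms by (auto simp: dirty_def intro: exI[of _ 0])
  qed (use assms grid_separation[of m n] in auto)
  ultimately show "search_number ?G = min m n + 1"
    by (simp add: search_number_eqI)
next
  let ?G = "cartesian_product (complete_graph m) (path_graph n)"
  obtain as where "succeeds ?G (Suc m) initial_state as"
    using product_path_sweep[OF simple_graph_complete_graph, of n m] assms
    by (auto simp: complete_verts)
  moreover have "\<not> succeeds ?G m initial_state as" for as
  proof (rule barrier[where low = "\<lambda>C. \<exists>i<m. \<forall>j<n. dirty C (i, j)"])
    show "simple_graph ?G"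
      by (intro simple_graph_cartesian_product simple_graph_complete_graph simple_graph_path_graph)
    show "\<not> (\<exists>i<m. \<forall>j<n. dirty (edges ?G) (i, j))"
    proof
      assume "\<exists>i<m. \<forall>j<n. dirty (edges ?G) (i, j)"
      then obtain i where "i < m" "dirty (edges ?G) (i, 0)" using assms by auto
      moreover have "{(i, 0), (i, Suc 0)} \<in> edges ?G"
        using \<open>i < m\<close> assms by (simp add: product_path_simps)
      ultimately show False by (auto simp: dirty_def)
    qed
    show "\<exists>i<m. \<forall>j<n. dirty {} (i, j)" using assms by (auto simp: dirty_def intro: exI[of _ 0])
  qed (use assms complete_path_separation[of m n] in auto)
  ultimately show "search_number ?G = m + 1"
    by (simp add: search_number_eqI)
qed

end
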